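(* Let $\Delta$ and $\Gamma$ be simplicial complexes on the same finite vertex set $V$. Then $$f_{\Delta}(q)\cdot f_{\Gamma}(q)\ \ll\ (1+q)^{|V|}\cdot f_{\Delta\cap\Gamma}(q).$$
   Context: For a simplicial complex $\Delta$ (a family of subsets of $V$ closed under taking subsets, including the empty face), its $f$-polynomial is $f_{\Delta}(q)=\sum_{i\ge 0} f_{i-1}(\Delta)q^i$, where $f_{i-1}(\Delta)$ is the number of faces of $\Delta$ of dimension $i-1$, i.e. with $i$ elements. $\Delta\cap\Gamma$ is the complex of common faces. For real polynomials, $p(q)\ll s(q)$ means $s(q)-p(q)$ has all coefficients nonnegative. *)

theory Defs
  imports "HOL-Computational_Algebra.Polynomial"
begin

definition simplicial_complex :: "'a set \<Rightarrow> 'a set set \<Rightarrow> bool" where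
  "simplicial_complex V \<Delta> \<longleftrightarrow>
     \<Delta> \<subseteq> Pow V \<and> {} \<in> \<Delta> \<and> (\<forall>F \<in> \<Delta>. \<forall>G. G \<subseteq> F \<longrightarrow> G \<in> \<Delta>)"

(* The number of faces with i elements, i.e. of dimension i - 1; usually written f with index i - 1. *)
definition face_number :: "'a set set \<Rightarrow> nat \<Rightarrow> nat" where
  "face_number \<Delta> i = card {F \<in> \<Delta>. card F = i}"

(* The sum over all i, cut off at the number of vertices, beyond which there are no faces;
   see coeff_f_polynomial. *)
definition f_polynomial :: "'a set set \<Rightarrow> real poly" where
  "f_polynomial \<Delta> = (\<Sum>i\<le>card (\<Union>\<Delta>). monom (of_nat (face_number \<Delta> i)) i)"

definition coeff_le :: "real poly \<Rightarrow> real poly \<Rightarrow> bool"  (infix "\<lless>" 50) where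
  "p \<lless> s \<longleftrightarrow> (\<forall>n. 0 \<le> coeff (s - p) n)"

lemma coeff_f_polynomial:
  assumes "finite V" "simplicial_complex V \<Delta>"
  shows "coeff (f_polynomial \<Delta>) i = of_nat (face_number \<Delta> i)"
proof (cases "i \<le> card (\<Union>\<Delta>)")
  case True
  then show ?thesis
    by (simp add: f_polynomial_def coeff_sum)
next
  case False
  have "finite (\<Union>\<Delta>)"
    using assms by (auto simp: simplicial_complex_def intro: finite_subset[of _ V])
  then have "card F \<le> card (\<Union>\<Delta>)" if "F \<in> \<Delta>" for F
    using that by (intro card_mono) auto
  then have "{F \<in> \<Delta>. card F = i} = {}"
    using False by auto
  then have "face_number \<Delta> i = 0"
    unfolding face_number_def by (simp only: card.empty)
  then show ?thesis
    using False by (simp add: f_polynomial_def coeff_sum)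
qed

end

theory Submission
  imports Defs
begin

text \<open>Induction on the vertex set. Splitting off a vertex \<open>v\<close>, let \<open>\<Delta>\<^sub>0\<close> be the deletion and
  \<open>\<Delta>\<^sub>1 \<subseteq> \<Delta>\<^sub>0\<close> the link of \<open>v\<close> in \<open>\<Delta>\<close>, so that \<open>f(\<Delta>) = f(\<Delta>\<^sub>0) + q f(\<Delta>\<^sub>1)\<close>, and likewise for \<open>\<Gamma>\<close>.
  With \<open>c\<^sub>i\<^sub>j = f(\<Delta>\<^sub>i \<inter> \<Gamma>\<^sub>j)\<close>, the induction hypothesis bounds the product by
  \<open>(1 + q)\<^sup>n (c\<^sub>0\<^sub>0 + q (c\<^sub>1\<^sub>0 + c\<^sub>0\<^sub>1) + q\<^sup>2 c\<^sub>1\<^sub>1)\<close>, whereas the claim allows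
  \<open>(1 + q)\<^sup>n (c\<^sub>0\<^sub>0 + q (c\<^sub>0\<^sub>0 + c\<^sub>1\<^sub>1) + q\<^sup>2 c\<^sub>1\<^sub>1)\<close>. The former is below the latter because
  \<open>\<Delta>\<^sub>1 \<inter> \<Gamma>\<^sub>0\<close> and \<open>\<Delta>\<^sub>0 \<inter> \<Gamma>\<^sub>1\<close> are subfamilies of \<open>\<Delta>\<^sub>0 \<inter> \<Gamma>\<^sub>0\<close> that meet in \<open>\<Delta>\<^sub>1 \<inter> \<Gamma>\<^sub>1\<close>.
  The link may be the void family, so the induction is over families closed under subsets that
  need not contain the empty face.\<close>

text \<open>Comparisons become membership in the cone of polynomials with nonnegative coefficients,
  whose closure under sums and products carries the final estimate.\<close>

lemma coeff_le_iff_diff: "p \<lless> s \<longleftrightarrow> 0 \<lless> s - p"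
  by (simp add: coeff_le_def)

lemma coeff_le_0_add: "0 \<lless> p \<Longrightarrow> 0 \<lless> s \<Longrightarrow> 0 \<lless> p + s"
  by (simp add: coeff_le_def)

lemma coeff_le_0_mult: "0 \<lless> p \<Longrightarrow> 0 \<lless> s \<Longrightarrow> 0 \<lless> p * s"
  by (simp add: coeff_le_def coeff_mult sum_nonneg)

lemma coeff_le_0_power: "0 \<lless> p \<Longrightarrow> 0 \<lless> p ^ n"
proof (induction n)
  case 0
  show ?case
    by (simp add: coeff_le_def coeff_1)
next
  case (Suc n)
  then show ?case
    by (simp only: power_Suc coeff_le_0_mult)
qed

lemma coeff_le_0_pCons: "0 \<le> a \<Longrightarrow> 0 \<lless> p \<Longrightarrow> 0 \<lless> pCons a p"
  by (simp add: coeff_le_def coeff_pCons split: nat.split)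

lemma coeff_le_0_sum: "(\<And>x. x \<in> A \<Longrightarrow> 0 \<lless> p x) \<Longrightarrow> 0 \<lless> sum p A"
  by (simp add: coeff_le_def coeff_sum sum_nonneg)

text \<open>Summing over the members themselves, with no cutoff on sizes, turns unions and
  bijections of families directly into polynomial identities.\<close>

definition size_poly :: "'a set set \<Rightarrow> real poly" where
  "size_poly A = (\<Sum>F\<in>A. monom 1 (card F))"

lemma f_polynomial_eq_size_poly:
  assumes "finite V" "simplicial_complex V \<Delta>"
  shows "f_polynomial \<Delta> = size_poly \<Delta>"
proof -
  have "finite \<Delta>"
    using assms by (auto simp: simplicial_complex_def intro: finite_subset)
  then show ?thesis
    by (intro poly_eqI)
      (simp add: coeff_f_polynomial[OF assms] size_poly_def coeff_sum face_number_def
        sum.If_cases Int_def)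
qed

text \<open>By inclusion-exclusion the expression is \<open>size_poly (C - (A \<union> B))\<close>,
  a sum of monomials.\<close>

lemma size_poly_supermodular:
  assumes "finite C" "A \<subseteq> C" "B \<subseteq> C"
  shows "0 \<lless> size_poly C + size_poly (A \<inter> B) - size_poly A - size_poly B"
proof -
  have fin: "finite A" "finite B"
    using assms finite_subset by blast+
  have "size_poly C = size_poly (C - (A \<union> B)) + size_poly (A \<union> B)"
    unfolding size_poly_def using assms by (intro sum.subset_diff) auto
  moreover have "size_poly (A \<union> B) + size_poly (A \<inter> B) = size_poly A + size_poly B"
    unfolding size_poly_def using fin by (rule sum.union_inter)
  ultimately have "size_poly C + size_poly (A \<inter> B) - size_poly A - size_poly B
      = size_poly (C - (A \<union> B))"
    by (simp add: algebra_simps)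
  moreover have "0 \<lless> size_poly (C - (A \<union> B))"
    unfolding size_poly_def by (intro coeff_le_0_sum) (simp add: coeff_le_def)
  ultimately show ?thesis
    by simp
qed

definition down_closed :: "'a set set \<Rightarrow> bool" where
  "down_closed A \<longleftrightarrow> (\<forall>F\<in>A. \<forall>G. G \<subseteq> F \<longrightarrow> G \<in> A)"

definition deletion :: "'a \<Rightarrow> 'a set set \<Rightarrow> 'a set set" where
  "deletion v A = {F \<in> A. v \<notin> F}"

definition link :: "'a \<Rightarrow> 'a set set \<Rightarrow> 'a set set" where
  "link v A = {F. v \<notin> F \<and> insert v F \<in> A}"

lemma down_closed_deletion: "down_closed A \<Longrightarrow> down_closed (deletion v A)"
  unfolding down_closed_def deletion_def by blast

lemma down_closed_link: "down_closed A \<Longrightarrow> down_closed (link v A)"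
  unfolding down_closed_def link_def by (auto dest: insert_mono)

lemma link_subset_deletion: "down_closed A \<Longrightarrow> link v A \<subseteq> deletion v A"
  unfolding down_closed_def link_def deletion_def by blast

lemma deletion_subset_Pow: "A \<subseteq> Pow (insert v V) \<Longrightarrow> deletion v A \<subseteq> Pow V"
  unfolding deletion_def by blast

lemma link_subset_Pow: "A \<subseteq> Pow (insert v V) \<Longrightarrow> link v A \<subseteq> Pow V"
  unfolding link_def by blast

lemma deletion_Int: "deletion v (A \<inter> B) = deletion v A \<inter> deletion v B"
  unfolding deletion_def by blast

lemma link_Int: "link v (A \<inter> B) = link v A \<inter> link v B"
  unfolding link_def by blast

text \<open>Members containing \<open>v\<close> correspond to the link via \<open>insert v\<close>,
  which raises the size by one; hence the factor \<open>[:0, 1:]\<close>.\<close>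

lemma size_poly_deletion_link:
  assumes "finite V" "A \<subseteq> Pow (insert v V)"
  shows "size_poly A = size_poly (deletion v A) + [:0, 1:] * size_poly (link v A)"
proof -
  have A: "A = deletion v A \<union> insert v ` link v A"
  proof (intro equalityI subsetI)
    fix F assume F: "F \<in> A"
    show "F \<in> deletion v A \<union> insert v ` link v A"
    proof (cases "v \<in> F")
      case True
      then have "F = insert v (F - {v})"
        by (simp add: insert_absorb)
      moreover from this have "F - {v} \<in> link v A"
        using F by (simp add: link_def)
      ultimately show ?thesis
        by (intro UnI2) (rule image_eqI)
    qed (simp add: F deletion_def)
  next
    fix F assume "F \<in> deletion v A \<union> insert v ` link v A"
    then show "F \<in> A"
      by (auto simp: deletion_def link_def)
  qed
  have fin: "finite (deletion v A)" "finite (link v A)"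
    using assms deletion_subset_Pow[OF assms(2)] link_subset_Pow[OF assms(2)]
    by (simp_all add: finite_subset[of _ "Pow V"])
  have inj: "inj_on (insert v) (link v A)"
    by (rule inj_onI) (simp add: link_def insert_ident)
  have "size_poly A = size_poly (deletion v A) + size_poly (insert v ` link v A)"
    unfolding size_poly_def
    by (subst A, rule sum.union_disjoint) (use fin in \<open>auto simp: deletion_def\<close>)
  also have "size_poly (insert v ` link v A) = (\<Sum>F\<in>link v A. [:0, 1:] * monom 1 (card F))"
    unfolding size_poly_def sum.reindex[OF inj] comp_def
  proof (rule sum.cong[OF refl])
    fix F assume "F \<in> link v A"
    moreover from this have "F \<subseteq> V"
      using link_subset_Pow[OF assms(2)] by blast
    ultimately have "v \<notin> F" "finite F"
      using finite_subset[OF _ assms(1)] by (simp_all add: link_def)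
    then show "monom 1 (card (insert v F)) = [:0, 1:] * monom (1 :: real) (card F)"
      by (simp add: monom_Suc)
  qed
  finally show ?thesis
    by (simp only: size_poly_def sum_distrib_left)
qed

lemma size_poly_mult_le:
  assumes "finite V" "A \<subseteq> Pow V" "B \<subseteq> Pow V" "down_closed A" "down_closed B"
  shows "size_poly A * size_poly B \<lless> [:1, 1:] ^ card V * size_poly (A \<inter> B)"
  using assms
proof (induction V arbitrary: A B rule: finite_induct)
  case empty
  \<comment> \<open>The size polynomials are 0 or 1 here, and both sides of the claim agree.\<close>
  then have "A = {} \<or> A = {{}}" "B = {} \<or> B = {{}}"
    by auto
  then show ?case
    by (auto simp: size_poly_def coeff_le_def)
next
  case (insert v V)
  define P :: "real poly" where "P = [:1, 1:] ^ card V"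
  define q :: "real poly" where "q = [:0, 1:]"
  define A0 A1 B0 B1 where "A0 = deletion v A" and "A1 = link v A"
    and "B0 = deletion v B" and "B1 = link v B"
  note defs = A0_def A1_def B0_def B1_def
  have sub: "A0 \<subseteq> Pow V" "A1 \<subseteq> Pow V" "B0 \<subseteq> Pow V" "B1 \<subseteq> Pow V"
    unfolding defs using insert.prems by (simp_all add: deletion_subset_Pow link_subset_Pow)
  have dc: "down_closed A0" "down_closed A1" "down_closed B0" "down_closed B1"
    unfolding defs using insert.prems by (simp_all add: down_closed_deletion down_closed_link)
  have A: "size_poly A = size_poly A0 + q * size_poly A1"
    and B: "size_poly B = size_poly B0 + q * size_poly B1"
    unfolding defs q_def using insert.hyps insert.prems
    by (simp_all only: size_poly_deletion_link[of V _ v])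
  have "A \<inter> B \<subseteq> Pow (insert v V)"
    using insert.prems by blast
  then have AB: "size_poly (A \<inter> B) = size_poly (A0 \<inter> B0) + q * size_poly (A1 \<inter> B1)"
    unfolding defs q_def using size_poly_deletion_link[OF insert.hyps(1)]
    by (simp only: deletion_Int link_Int)
  have IH: "0 \<lless> P * size_poly (C \<inter> D) - size_poly C * size_poly D"
    if "C \<in> {A0, A1}" "D \<in> {B0, B1}" for C D
    using insert.IH[of C D] sub dc that unfolding P_def by (auto simp: coeff_le_iff_diff[symmetric])
  have "A1 \<subseteq> A0" "B1 \<subseteq> B0"
    unfolding defs using insert.prems by (simp_all add: link_subset_deletion)
  moreover from this have "A1 \<inter> B1 = (A1 \<inter> B0) \<inter> (A0 \<inter> B1)"
    by blast
  moreover have "finite (A0 \<inter> B0)"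
    using sub insert.hyps by (meson finite_Int finite_Pow_iff finite_subset)
  ultimately have "0 \<lless> size_poly (A0 \<inter> B0) + size_poly (A1 \<inter> B1)
      - size_poly (A1 \<inter> B0) - size_poly (A0 \<inter> B1)" (is "0 \<lless> ?S")
    using size_poly_supermodular[of "A0 \<inter> B0" "A1 \<inter> B0" "A0 \<inter> B1"] by auto
  moreover have q: "0 \<lless> q" and "0 \<lless> P"
    unfolding q_def P_def
    by (intro coeff_le_0_power coeff_le_0_pCons; simp add: coeff_le_def)+
  \<comment> \<open>Each of the four instances of \<open>IH\<close> is weighted by the power of
    \<open>q\<close> that its product has in \<open>size_poly A * size_poly B\<close>. The last
    summand trades the mixed intersections for \<open>A0 \<inter> B0\<close> and
    \<open>A1 \<inter> B1\<close>, so that the positive terms factor as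
    \<open>(1 + q) * P * size_poly (A \<inter> B)\<close>.\<close>
  ultimately have "0 \<lless> (P * size_poly (A0 \<inter> B0) - size_poly A0 * size_poly B0)
      + q * (P * size_poly (A1 \<inter> B0) - size_poly A1 * size_poly B0)
      + q * (P * size_poly (A0 \<inter> B1) - size_poly A0 * size_poly B1)
      + q * (q * (P * size_poly (A1 \<inter> B1) - size_poly A1 * size_poly B1))
      + q * (P * ?S)" (is "0 \<lless> ?R")
    by (intro coeff_le_0_add coeff_le_0_mult IH) auto
  also have "?R = (1 + q) * P * size_poly (A \<inter> B) - size_poly A * size_poly B"
    unfolding A B AB by (simp add: algebra_simps)
  also have "1 + q = [:1, 1:]"
    by (simp add: q_def one_pCons)
  finally show ?case
    using insert.hyps by (simp add: P_def coeff_le_iff_diff[symmetric])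
qed

theorem theorem3p1:
  fixes V :: "'a set" and \<Delta> \<Gamma> :: "'a set set"
  assumes "finite V"
    and "simplicial_complex V \<Delta>"
    and "simplicial_complex V \<Gamma>"
  shows "f_polynomial \<Delta> * f_polynomial \<Gamma> \<lless> [:1, 1:] ^ card V * f_polynomial (\<Delta> \<inter> \<Gamma>)"
proof -
  \<comment> \<open>The passage from \<open>f_polynomial\<close> to \<open>size_poly\<close> must
    apply to the intersection too.\<close>
  have "simplicial_complex V (\<Delta> \<inter> \<Gamma>)"
    using assms(2,3) unfolding simplicial_complex_def by (simp add: le_infI1) (metis IntD1 IntD2)
  moreover have "size_poly \<Delta> * size_poly \<Gamma> \<lless> [:1, 1:] ^ card V * size_poly (\<Delta> \<inter> \<Gamma>)"
    using assms by (intro size_poly_mult_le) (auto simp: simplicial_complex_def down_closed_def)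
  ultimately show ?thesis
    by (simp only: assms f_polynomial_eq_size_poly[OF assms(1)])
qed

end
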